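(* Let $\Theta$ be a substitution schema and let $\mathcal{U}$ be a finite set of unification equations that is unifiable (in the usual syntactic first-order sense). Then $\mathrm{store}_\Theta(\mathcal{U})\neq\bot$.
   Context: Variables are objects $X_i$ with $X$ from a countably infinite set $\mathcal{V}_{sym}$ of variable symbols and $i\in\mathbb{N}$; terms are first-order terms over a signature $\Sigma$ and these variables; $\mathrm{cls}(X_i)=\{X\}$. $\mathrm{shift}_d$ adds $d$ to every variable index in a term. A substitution schema $\Theta$ is given by pairwise distinct symbols $X^1,\dots,X^n$ and terms $t_1,\dots,t_n$, and is the infinite mapping $\{X^i_j\mapsto\mathrm{shift}_j(t_i)\mid 1\le i\le n, j\ge0\}$, with $\mathrm{dom}(\Theta)=\{X^1,\dots,X^n\}$. For a variable $x$ write $x\in\Theta$ if $\mathrm{cls}(x)\subseteq\mathrm{dom}(\Theta)$, and $x\notin\Theta$ otherwise. For a term $t$, $\Theta^t$ is the substitution sending each variable $x$ of $t$ with $x\in\Theta$ to its image under $\Theta$ and fixing all other variables; $\Theta^t(0)=t$ and $\Theta^t(k+1)=s\Theta^s$ with $s=\Theta^t(k)$. $\Theta$-unification. A configuration is a pair $(\mathcal{S},\mathcal{U})$ of sets of equations (store, active set). Starting from $(\emptyset,\mathcal{U})$, the procedure first saturates the active set under: Decomposition (replace $f(r_1,\dots,r_n)\stackrel{?}{=}f(s_1,\dots,s_n)$ by the $r_i\stackrel{?}{=}s_i$); Orient-1 (replace $r\stackrel{?}{=}x$, $x$ a variable, $r$ not a variable, by $x\stackrel{?}{=}r$); Orient-2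 (for variables, if $y\stackrel{?}{=}x$ is present and $x\stackrel{?}{=}y$ not, add $x\stackrel{?}{=}y$); Transitivity (from $x\stackrel{?}{=}r$, $x\stackrel{?}{=}s$, $x$ a variable, $r\ne s$, add $r\stackrel{?}{=}s$); Reflexive (remove $t\stackrel{?}{=}t$); Clash (an equation between non-variable terms with different heads makes the procedure fail). Then Store is applied as long as possible, moving $y\stackrel{?}{=}r$ ($y$ a variable) from the active set to the store if (1) $y\in\Theta$ and, if $r$ is a variable, $r\in\Theta$; or (2) $y\notin\Theta$ and some $x\stackrel{?}{=}s'$ in the store has $y$ occurring in $s'$, or $r=x$, or $y=x$; or (3) $y\notin\Theta$ and for some variable $z\in\Theta$ occurring in the store and some $k\ge0$, $y$ occurs in $\Theta^z(k)$. Finally syntactic unification is run on store $\cup$ active set and the procedure fails if it fails (clash or occurs check). The resulting configuration is the final configuration $\mathrm{fin}_\Theta(\mathcal{U})$ and its store is $\mathrm{store}_\Theta(\mathcal{U})$; if the procedure fails, $\mathrm{store}_\Theta(\mathcal{U})=\bot$.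
   Formalization: Read literally, saturation need not end (for x=f(y), x=f(z), Transitivity re-adds f(y)=f(z) after each Decomposition); here Transitivity may add each equation at most once. The store is not ⊥ when no run fails and some run completes. *)

theory Defs
  imports Main "HOL-Library.Countable" "HOL-Library.Infinite_Typeclass"
begin

section \<open>Terms and substitutions\<close>

datatype (funs: 'f, vars: 'x) trm = Var 'x | Fun 'f "('f, 'x) trm list"

text \<open>The variable \<open>X\<^sub>i\<close> is the pair \<open>(X, i)\<close>.\<close>

type_synonym 'v var = "'v \<times> nat"

type_synonym ('f, 'v) vtrm = "('f, 'v var) trm"

type_synonym ('f, 'v) eqn = "('f, 'v) vtrm \<times> ('f, 'v) vtrm"

text \<open>The signature is the type of function symbols together with their arities \<open>ar\<close>.\<close>

fun wf_trm :: "('f \<Rightarrow> nat) \<Rightarrow> ('f, 'x) trm \<Rightarrow> bool" where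
  "wf_trm ar (Var x) \<longleftrightarrow> True"
| "wf_trm ar (Fun f ts) \<longleftrightarrow> length ts = ar f \<and> (\<forall>t \<in> set ts. wf_trm ar t)"

fun is_Variable :: "('f, 'x) trm \<Rightarrow> bool" where
  "is_Variable (Var x) \<longleftrightarrow> True"
| "is_Variable (Fun f ts) \<longleftrightarrow> False"

fun subst :: "('f, 'x) trm \<Rightarrow> ('x \<Rightarrow> ('f, 'x) trm) \<Rightarrow> ('f, 'x) trm" (infixl \<open>\<cdot>\<close> 67) where
  "Var x \<cdot> \<sigma> = \<sigma> x"
| "Fun f ts \<cdot> \<sigma> = Fun f (map (\<lambda>t. t \<cdot> \<sigma>) ts)"

definition vars_eqns :: "(('f, 'x) trm \<times> ('f, 'x) trm) set \<Rightarrow> 'x set" where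
  "vars_eqns E = (\<Union>(s, t) \<in> E. vars s \<union> vars t)"

definition wf_eqns :: "('f \<Rightarrow> nat) \<Rightarrow> (('f, 'x) trm \<times> ('f, 'x) trm) set \<Rightarrow> bool" where
  "wf_eqns ar E \<longleftrightarrow> (\<forall>(s, t) \<in> E. wf_trm ar s \<and> wf_trm ar t)"

definition unifiable :: "('f \<Rightarrow> nat) \<Rightarrow> (('f, 'x) trm \<times> ('f, 'x) trm) set \<Rightarrow> bool" where
  "unifiable ar E \<longleftrightarrow>
     (\<exists>\<sigma>. (\<forall>x. wf_trm ar (\<sigma> x)) \<and> (\<forall>(s, t) \<in> E. s \<cdot> \<sigma> = t \<cdot> \<sigma>))"

section \<open>Substitution schemata\<close>

definition cls :: "'v var \<Rightarrow> 'v set" where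
  "cls x = {fst x}"

definition shift :: "nat \<Rightarrow> ('f, 'v) vtrm \<Rightarrow> ('f, 'v) vtrm" where
  "shift d = map_trm id (\<lambda>(X, i). (X, i + d))"

text \<open>The list \<open>[(X\<^sup>1, t\<^sub>1), \<dots>, (X\<^sup>n, t\<^sub>n)]\<close> represents the infinite mapping
  \<open>X\<^sup>i\<^sub>j \<mapsto> shift j t\<^sub>i\<close>.\<close>

type_synonym ('f, 'v) schema = "('v \<times> ('f, 'v) vtrm) list"

definition substitution_schema :: "('f \<Rightarrow> nat) \<Rightarrow> ('f, 'v) schema \<Rightarrow> bool" where
  "substitution_schema ar \<Theta> \<longleftrightarrow> distinct (map fst \<Theta>) \<and> (\<forall>(X, t) \<in> set \<Theta>. wf_trm ar t)"

definition schema_dom :: "('f, 'v) schema \<Rightarrow> 'v set" where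
  "schema_dom \<Theta> = fst ` set \<Theta>"

definition in_schema :: "'v var \<Rightarrow> ('f, 'v) schema \<Rightarrow> bool" where
  "in_schema x \<Theta> \<longleftrightarrow> cls x \<subseteq> schema_dom \<Theta>"

definition schema_image :: "('f, 'v) schema \<Rightarrow> 'v var \<Rightarrow> ('f, 'v) vtrm" where
  "schema_image \<Theta> x = (case x of (X, j) \<Rightarrow> shift j (the (map_of \<Theta> X)))"

definition schema_subst :: "('f, 'v) schema \<Rightarrow> ('f, 'v) vtrm \<Rightarrow> 'v var \<Rightarrow> ('f, 'v) vtrm" where
  "schema_subst \<Theta> t x = (if x \<in> vars t \<and> in_schema x \<Theta> then schema_image \<Theta> x else Var x)"

primrec schema_iter :: "('f, 'v) schema \<Rightarrow> ('f, 'v) vtrm \<Rightarrow> nat \<Rightarrow> ('f, 'v) vtrm" where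
  "schema_iter \<Theta> t 0 = t"
| "schema_iter \<Theta> t (Suc k) = (let s = schema_iter \<Theta> t k in s \<cdot> schema_subst \<Theta> s)"

section \<open>Syntactic unification\<close>

definition clash :: "(('f, 'x) trm \<times> ('f, 'x) trm) set \<Rightarrow> bool" where
  "clash E \<longleftrightarrow> (\<exists>f g rs ss. (Fun f rs, Fun g ss) \<in> E \<and> f \<noteq> g)"

definition occurs_check :: "(('f, 'x) trm \<times> ('f, 'x) trm) set \<Rightarrow> bool" where
  "occurs_check E \<longleftrightarrow> (\<exists>x t. (Var x, t) \<in> E \<and> t \<noteq> Var x \<and> x \<in> vars t)"

inductive unif_step ::
  "(('f, 'x) trm \<times> ('f, 'x) trm) set \<Rightarrow> (('f, 'x) trm \<times> ('f, 'x) trm) set \<Rightarrow> bool" where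
  delete: "(t, t) \<in> E \<Longrightarrow> unif_step E (E - {(t, t)})"
| decompose: "(Fun f rs, Fun f ss) \<in> E \<Longrightarrow> length rs = length ss \<Longrightarrow>
    unif_step E ((E - {(Fun f rs, Fun f ss)}) \<union> set (zip rs ss))"
| orient: "(r, Var x) \<in> E \<Longrightarrow> \<not> is_Variable r \<Longrightarrow>
    unif_step E (insert (Var x, r) (E - {(r, Var x)}))"
| eliminate: "(Var x, t) \<in> E \<Longrightarrow> x \<notin> vars t \<Longrightarrow> x \<in> vars_eqns (E - {(Var x, t)}) \<Longrightarrow>
    unif_step E (insert (Var x, t)
      ((\<lambda>(r, s). (r \<cdot> Var(x := t), s \<cdot> Var(x := t))) ` (E - {(Var x, t)})))"

definition unif_fails :: "(('f, 'x) trm \<times> ('f, 'x) trm) set \<Rightarrow> bool" where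
  "unif_fails E \<longleftrightarrow> (\<exists>E'. unif_step\<^sup>*\<^sup>* E E' \<and> (clash E' \<or> occurs_check E'))"

section \<open>Unification modulo a substitution schema\<close>

text \<open>Transitivity keeps its premises, while Decomposition and Orient-1 remove the equation that
  Transitivity adds; so, to make saturation a terminating process, every equation is added by
  Transitivity at most once. A state \<open>(H, A)\<close> consists of the set \<open>H\<close> of equations that
  Transitivity has already added and the active set \<open>A\<close>.\<close>

inductive sat_step ::
  "('f, 'v) eqn set \<times> ('f, 'v) eqn set \<Rightarrow> ('f, 'v) eqn set \<times> ('f, 'v) eqn set \<Rightarrow> bool" where
  decomposition: "(Fun f rs, Fun f ss) \<in> A \<Longrightarrow> length rs = length ss \<Longrightarrow>
    sat_step (H, A) (H, (A - {(Fun f rs, Fun f ss)}) \<union> set (zip rs ss))"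
| orient_1: "(r, Var x) \<in> A \<Longrightarrow> \<not> is_Variable r \<Longrightarrow>
    sat_step (H, A) (H, insert (Var x, r) (A - {(r, Var x)}))"
| orient_2: "(Var y, Var x) \<in> A \<Longrightarrow> (Var x, Var y) \<notin> A \<Longrightarrow>
    sat_step (H, A) (H, insert (Var x, Var y) A)"
| transitivity: "(Var x, r) \<in> A \<Longrightarrow> (Var x, s) \<in> A \<Longrightarrow> r \<noteq> s \<Longrightarrow> (r, s) \<notin> H \<Longrightarrow>
    sat_step (H, A) (insert (r, s) H, insert (r, s) A)"
| reflexive: "(t, t) \<in> A \<Longrightarrow> sat_step (H, A) (H, A - {(t, t)})"

text \<open>A configuration is a pair of a store and an active set.\<close>

type_synonym ('f, 'v) config = "('f, 'v) eqn set \<times> ('f, 'v) eqn set"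

definition storable ::
  "('f, 'v) schema \<Rightarrow> ('f, 'v) eqn set \<Rightarrow> 'v var \<Rightarrow> ('f, 'v) vtrm \<Rightarrow> bool" where
  "storable \<Theta> S y r \<longleftrightarrow>
     in_schema y \<Theta> \<and> (\<forall>x. r = Var x \<longrightarrow> in_schema x \<Theta>)
   \<or> \<not> in_schema y \<Theta> \<and> (\<exists>x s'. (Var x, s') \<in> S \<and> (y \<in> vars s' \<or> r = Var x \<or> y = x))
   \<or> \<not> in_schema y \<Theta> \<and>
       (\<exists>z k. in_schema z \<Theta> \<and> z \<in> vars_eqns S \<and> y \<in> vars (schema_iter \<Theta> (Var z) k))"

inductive store_step :: "('f, 'v) schema \<Rightarrow> ('f, 'v) config \<Rightarrow> ('f, 'v) config \<Rightarrow> bool"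
  for \<Theta> where
  "(Var y, r) \<in> A \<Longrightarrow> storable \<Theta> S y r \<Longrightarrow>
    store_step \<Theta> (S, A) (insert (Var y, r) S, A - {(Var y, r)})"

text \<open>\<open>theta_unif \<Theta> U out\<close> means that some complete run of the procedure on \<open>U\<close> has the
  outcome \<open>out\<close>, where \<open>None\<close> is failure.\<close>

inductive theta_unif ::
  "('f, 'v) schema \<Rightarrow> ('f, 'v) eqn set \<Rightarrow> ('f, 'v) config option \<Rightarrow> bool"
  for \<Theta> U where
  fail_clash: "sat_step\<^sup>*\<^sup>* ({}, U) (H, A) \<Longrightarrow> clash A \<Longrightarrow> theta_unif \<Theta> U None"
| fail_unif: "sat_step\<^sup>*\<^sup>* ({}, U) (H, A) \<Longrightarrow> \<not> clash A \<Longrightarrow> \<nexists>c. sat_step (H, A) c \<Longrightarrow>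
    (store_step \<Theta>)\<^sup>*\<^sup>* ({}, A) (S', A') \<Longrightarrow> \<nexists>c. store_step \<Theta> (S', A') c \<Longrightarrow>
    unif_fails (S' \<union> A') \<Longrightarrow> theta_unif \<Theta> U None"
| success: "sat_step\<^sup>*\<^sup>* ({}, U) (H, A) \<Longrightarrow> \<not> clash A \<Longrightarrow> \<nexists>c. sat_step (H, A) c \<Longrightarrow>
    (store_step \<Theta>)\<^sup>*\<^sup>* ({}, A) (S', A') \<Longrightarrow> \<nexists>c. store_step \<Theta> (S', A') c \<Longrightarrow>
    \<not> unif_fails (S' \<union> A') \<Longrightarrow> theta_unif \<Theta> U (Some (S', A'))"

text \<open>The rules may be applied in any order. The result is \<open>None\<close>, for \<open>\<bottom>\<close>, as soon as one run
  fails, and also if no run reaches a final configuration.\<close>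

definition fin_config :: "('f, 'v) schema \<Rightarrow> ('f, 'v) eqn set \<Rightarrow> ('f, 'v) config option" where
  "fin_config \<Theta> U =
     (if theta_unif \<Theta> U None \<or> (\<nexists>c. theta_unif \<Theta> U (Some c)) then None
      else Some (SOME c. theta_unif \<Theta> U (Some c)))"

definition store_of :: "('f, 'v) schema \<Rightarrow> ('f, 'v) eqn set \<Rightarrow> ('f, 'v) eqn set option" where
  "store_of \<Theta> U = map_option fst (fin_config \<Theta> U)"

end

theory Submission
  imports Defs
begin

text \<open>A unifier of \<open>U\<close> unifies every set of equations derived from \<open>U\<close>, in saturation, storing and
  syntactic unification alike, and it rules out clashes and, by comparing sizes, failing occurs
  checks. Hence no run fails. Saturation only produces equations between subterms of \<open>U\<close>, and it
  terminates by the lexicographic order on the number of equations that Transitivity may still add,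
  the number of missing equations between distinct variables (which no rule removes), and a
  weighted size of the active set in which non-variable left-hand sides count extra.
  Storing shrinks the active set. Hence some run is complete.\<close>

section \<open>Unifiers are preserved\<close>

definition unifies :: "('x \<Rightarrow> ('f, 'x) trm) \<Rightarrow> (('f, 'x) trm \<times> ('f, 'x) trm) set \<Rightarrow> bool" where
  "unifies \<sigma> E \<longleftrightarrow> (\<forall>(s, t) \<in> E. s \<cdot> \<sigma> = t \<cdot> \<sigma>)"

lemma unifies_insert [simp]: "unifies \<sigma> (insert (s, t) E) \<longleftrightarrow> s \<cdot> \<sigma> = t \<cdot> \<sigma> \<and> unifies \<sigma> E"
  and unifies_Un [simp]: "unifies \<sigma> (E \<union> F) \<longleftrightarrow> unifies \<sigma> E \<and> unifies \<sigma> F"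
  by (auto simp: unifies_def)

lemma unifies_Diff: "unifies \<sigma> E \<Longrightarrow> unifies \<sigma> (E - F)"
  by (auto simp: unifies_def)

lemma unifiesD: "unifies \<sigma> E \<Longrightarrow> (s, t) \<in> E \<Longrightarrow> s \<cdot> \<sigma> = t \<cdot> \<sigma>"
  by (auto simp: unifies_def)

lemma unifies_zip:
  assumes "Fun f rs \<cdot> \<sigma> = Fun g ss \<cdot> \<sigma>"
  shows "unifies \<sigma> (set (zip rs ss))"
proof -
  have "map (\<lambda>t. t \<cdot> \<sigma>) rs = map (\<lambda>t. t \<cdot> \<sigma>) ss"
    using assms by simp
  then show ?thesis
    by (auto simp: unifies_def in_set_zip dest: map_eq_imp_length_eq) (metis nth_map)
qed

text \<open>Makes variable elimination harmless: \<open>\<sigma>\<close> already identifies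
  \<open>x\<close> with \<open>t\<close>, so the very same \<open>\<sigma>\<close> unifies the
  instantiated equations.\<close>

lemma subst_absorb: "\<sigma> x = t \<cdot> \<sigma> \<Longrightarrow> r \<cdot> Var(x := t) \<cdot> \<sigma> = r \<cdot> \<sigma>"
  by (induction r) auto

lemma unif_step_unifies: "unif_step E E' \<Longrightarrow> unifies \<sigma> E \<Longrightarrow> unifies \<sigma> E'"
proof (induction rule: unif_step.induct)
  case (decompose f rs ss E)
  then show ?case
    by (metis unifiesD unifies_Diff unifies_Un unifies_zip)
next
  case (eliminate x t E)
  then have "\<sigma> x = t \<cdot> \<sigma>"
    using unifiesD by fastforce
  then show ?case
    using eliminate by (auto simp: unifies_def subst_absorb)
qed (auto simp: unifies_Diff dest: unifiesD)

lemma sat_step_unifies: "sat_step (H, A) (H', A') \<Longrightarrow> unifies \<sigma> A \<Longrightarrow> unifies \<sigma> A'"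
proof (induction "(H, A)" "(H', A')" arbitrary: H A H' A' rule: sat_step.induct)
  case (decomposition f rs ss A H)
  then show ?case
    by (metis unifiesD unifies_Diff unifies_Un unifies_zip)
next
  case (transitivity x r A s H)
  then show ?case
    by (metis unifiesD unifies_insert)
qed (auto simp: unifies_Diff dest: unifiesD)

lemma sat_steps_unifies:
  assumes "sat_step\<^sup>*\<^sup>* (H, A) (H', A')" and "unifies \<sigma> A"
  shows "unifies \<sigma> A'"
  using assms by (induction rule: rtranclp_induct2) (auto intro: sat_step_unifies)

text \<open>A storing step only moves an equation, so the final unification sees exactly the
  saturated set, whichever equations are \<open>storable\<close>.\<close>

lemma store_steps_union:
  assumes "(store_step \<Theta>)\<^sup>*\<^sup>* (S, A) (S', A')"
  shows "S' \<union> A' = S \<union> A"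
  using assms by (induction rule: rtranclp_induct2) (auto elim!: store_step.cases)

section \<open>Unifiable sets cause no failure\<close>

lemma unifies_not_clash: "unifies \<sigma> E \<Longrightarrow> \<not> clash E"
  by (auto simp: clash_def dest: unifiesD)

text \<open>Each function symbol above an occurrence of \<open>x\<close> survives in the instance
  and adds to its size. A failing occurs check would thus make \<open>\<sigma> x\<close> larger than
  itself.\<close>

lemma size_subst_vars:
  assumes "x \<in> vars t"
  shows "t = Var x \<or> size (\<sigma> x) < size (t \<cdot> \<sigma>)"
  using assms
proof (induction t)
  case (Fun f ts)
  then obtain t where t: "t \<in> set ts" "x \<in> vars t"
    by auto
  then have "size (\<sigma> x) \<le> size (t \<cdot> \<sigma>)"
    using Fun.IH by fastforce
  moreover have "size (t \<cdot> \<sigma>) < size (Fun f ts \<cdot> \<sigma>)"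
    using size_list_estimation[of "t \<cdot> \<sigma>" "map (\<lambda>t. t \<cdot> \<sigma>) ts" _ size] t(1)
    by (simp add: size_list_estimation' less_Suc_eq_le)
  ultimately show ?case
    by simp
qed simp

lemma unifies_not_occurs_check: "unifies \<sigma> E \<Longrightarrow> \<not> occurs_check E"
  unfolding occurs_check_def
  by (metis less_irrefl size_subst_vars subst.simps(1) unifiesD)

lemma unifies_not_unif_fails:
  assumes "unifies \<sigma> E"
  shows "\<not> unif_fails E"
proof -
  have "unifies \<sigma> E'" if "unif_step\<^sup>*\<^sup>* E E'" for E'
    using that assms by induction (auto intro: unif_step_unifies)
  then show ?thesis
    using unifies_not_clash unifies_not_occurs_check unfolding unif_fails_def by blast
qed

lemma unifies_not_theta_unif_None:
  assumes "unifies \<sigma> U"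
  shows "\<not> theta_unif \<Theta> U None"
proof
  assume "theta_unif \<Theta> U None"
  then show False
  proof cases
    case (fail_clash H A)
    then show False
      using assms sat_steps_unifies unifies_not_clash by blast
  next
    case (fail_unif H A S' A')
    then show False
      using assms sat_steps_unifies unifies_not_unif_fails store_steps_union by (metis Un_empty_left)
  qed
qed

section \<open>Existence of complete runs\<close>

text \<open>The invariant \<open>P\<close> confines the descent to states where the measure is
  meaningful; with cardinalities and sums this means finite sets.\<close>

lemma normal_form_exists:
  assumes "wf R" and "P a"
    and "\<And>a b. P a \<Longrightarrow> step a b \<Longrightarrow> P b \<and> (b, a) \<in> R"
  shows "\<exists>b. step\<^sup>*\<^sup>* a b \<and> (\<nexists>c. step b c)"
  using \<open>wf R\<close> \<open>P a\<close>
proof (induction a rule: wf_induct_rule)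
  case (less a)
  then show ?case
    using assms(3) by (metis converse_rtranclp_into_rtranclp rtranclp.rtrancl_refl)
qed

section \<open>Termination of saturation\<close>

fun subterms :: "('f, 'x) trm \<Rightarrow> ('f, 'x) trm set" where
  "subterms (Var x) = {Var x}"
| "subterms (Fun f ts) = insert (Fun f ts) (\<Union>t \<in> set ts. subterms t)"

lemma finite_subterms: "finite (subterms t)"
  by (induction t) auto

lemma subterms_refl: "t \<in> subterms t"
  by (cases t) auto

lemma args_in_subterms: "Fun f ts \<in> subterms t \<Longrightarrow> set ts \<subseteq> subterms t"
proof (induction t)
  case (Fun g us)
  then show ?case
    using subterms_refl by (cases "Fun f ts = Fun g us") fastforce+
qed simp

text \<open>\<open>T \<times> T\<close> will bound the active sets: Decomposition needs closure
  under arguments, and the other rules only recombine sides already present.\<close>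

lemma finite_subterm_closed_superset:
  fixes U :: "(('f, 'x) trm \<times> ('f, 'x) trm) set"
  assumes "finite U"
  obtains T where "finite T" "U \<subseteq> T \<times> T" "\<And>f ts. Fun f ts \<in> T \<Longrightarrow> set ts \<subseteq> T"
proof
  let ?T = "\<Union>(s, t) \<in> U. subterms s \<union> subterms t"
  show "finite ?T"
    using assms by (auto simp: finite_subterms)
  show "U \<subseteq> ?T \<times> ?T"
    using subterms_refl by fast
  show "set ts \<subseteq> ?T" if "Fun f ts \<in> ?T" for f ts
    using that by (auto dest: args_in_subterms)
qed

text \<open>The constant 1 makes every deletion count, even of an equation between variables; the
  last summand is what Orient-1 saves by swapping the sides.\<close>

definition eqn_weight :: "('f, 'x) trm \<times> ('f, 'x) trm \<Rightarrow> nat" where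
  "eqn_weight e = 1 + size (fst e) + size (snd e) + of_bool (\<not> is_Variable (fst e))"

lemma sum_set_le_sum_list: "sum f (set xs) \<le> (\<Sum>x \<leftarrow> xs. f x :: nat)"
  by (induction xs) (auto simp: sum.insert_if)

text \<open>The size of an argument list counts one extra per entry. The two lists together thus pay
  for the constant and the possible penalty of each new equation.\<close>

lemma eqn_weight_zip:
  assumes "length rs = length ss"
  shows "sum eqn_weight (set (zip rs ss)) < eqn_weight (Fun f rs, Fun g ss)"
proof -
  have "(\<Sum>e \<leftarrow> zip rs ss. eqn_weight e) < eqn_weight (Fun f rs, Fun g ss)"
    using assms by (induction rs ss rule: list_induct2) (auto simp: eqn_weight_def)
  then show ?thesis
    using sum_set_le_sum_list le_less_trans by blast
qed

text \<open>\<open>B\<close> may overlap the rest of \<open>A\<close>; merging equal elements only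
  lowers the sum.\<close>

lemma sum_weight_replace:
  fixes w :: "'a \<Rightarrow> nat"
  assumes "finite A" "finite B" "e \<in> A" "sum w B < w e"
  shows "sum w ((A - {e}) \<union> B) < sum w A"
proof -
  have "sum w ((A - {e}) \<union> B) \<le> sum w (A - {e}) + sum w B"
    using assms by (simp add: sum_Un_nat)
  also have "\<dots> < sum w A"
    using assms by (simp add: sum.remove)
  finally show ?thesis .
qed

text \<open>Transitivity lowers the first component, Orient-2 the second and the other rules the
  third. The order matters, since the first two rules increase the weight of the active set.\<close>

definition sat_measure ::
  "('f, 'v) vtrm set \<Rightarrow> ('f, 'v) eqn set \<times> ('f, 'v) eqn set \<Rightarrow> nat \<times> nat \<times> nat" where
  "sat_measure T = (\<lambda>(H, A).
     (card (T \<times> T - H),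
      card ({(Var x, Var y) | x y. x \<noteq> y} \<inter> T \<times> T - A),
      sum eqn_weight A))"

lemma sat_step_decreases:
  assumes "sat_step (H, A) (H', A')" and "finite T"
    and closed: "\<And>f ts. Fun f ts \<in> T \<Longrightarrow> set ts \<subseteq> T"
    and "A \<subseteq> T \<times> T"
  shows "A' \<subseteq> T \<times> T"
    and "(sat_measure T (H', A'), sat_measure T (H, A)) \<in> less_than <*lex*> less_than <*lex*> less_than"
proof -
  let ?V = "{(Var x, Var y) | x y. x \<noteq> y} \<inter> T \<times> T :: ('a, 'b) eqn set"
  have "finite (T \<times> T)"
    using assms(2) by simp
  then have fin: "finite A" "finite (T \<times> T)"
    using assms(4) finite_subset by blast+
  \<comment> \<open>Equality may fail, as Decomposition can produce equations between variables; a
    smaller second component is just as good.\<close>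
  have mono: "card (?V - A') \<le> card (?V - A)" if "?V - A' \<subseteq> ?V - A"
    using that fin(2) by (intro card_mono finite_Diff finite_Int disjI2)
  have "A' \<subseteq> T \<times> T \<and>
    (sat_measure T (H', A'), sat_measure T (H, A)) \<in> less_than <*lex*> less_than <*lex*> less_than"
    using assms(1)
  proof cases
    case (decomposition f rs ss)
    have "set rs \<subseteq> T" "set ss \<subseteq> T"
      using closed decomposition(3) assms(4) by blast+
    then have "set (zip rs ss) \<subseteq> T \<times> T"
      by (auto dest: set_zip_leftD set_zip_rightD)
    moreover have "sum eqn_weight A' < sum eqn_weight A"
      unfolding decomposition(2)
      using decomposition fin by (intro sum_weight_replace eqn_weight_zip) auto
    \<comment> \<open>The removed equation has function symbols on both sides, hence lies outside
      \<open>?V\<close>.\<close>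
    moreover have "?V - A' \<subseteq> ?V - A"
      using decomposition by auto
    ultimately show ?thesis
      using decomposition assms(4) mono by (auto simp: sat_measure_def)
  next
    case (orient_1 r x)
    have "eqn_weight (Var x, r) < eqn_weight (r, Var x)"
      using orient_1(4) by (cases r) (auto simp: eqn_weight_def)
    then have "sum eqn_weight A' < sum eqn_weight A"
      using sum_weight_replace[of A "{(Var x, r)}" "(r, Var x)" eqn_weight] fin(1) orient_1(2,3)
      by simp
    moreover have "?V - A' \<subseteq> ?V - A"
      using orient_1 by auto
    ultimately show ?thesis
      using orient_1 assms(4) mono by (auto simp: sat_measure_def)
  next
    case (orient_2 y x)
    \<comment> \<open>Otherwise the equation and its mirror image would coincide, being both present
      and absent.\<close>
    then have "x \<noteq> y"
      by auto
    with orient_2 have "(Var x, Var y) \<in> ?V - A"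
      using assms(4) by blast
    then have "card (?V - A') < card (?V - A)"
      unfolding orient_2(2) using fin(2) by (intro psubset_card_mono finite_Diff finite_Int) blast+
    then show ?thesis
      using orient_2 assms(4) by (auto simp: sat_measure_def)
  next
    case (transitivity x r s)
    then have "(r, s) \<in> T \<times> T - H"
      using assms(4) by auto
    then have "card (T \<times> T - H') < card (T \<times> T - H)"
      unfolding transitivity(1) using fin(2) by (intro psubset_card_mono finite_Diff) blast+
    then show ?thesis
      using transitivity assms(4) by (auto simp: sat_measure_def)
  next
    case (reflexive t)
    then have "sum eqn_weight A' < sum eqn_weight A"
      using sum_weight_replace[of A "{}" "(t, t)" eqn_weight] fin(1) by (simp add: eqn_weight_def)
    moreover have "?V - A' \<subseteq> ?V - A"
      using reflexive by auto
    ultimately show ?thesis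
      using reflexive assms(4) mono by (auto simp: sat_measure_def)
  qed
  then show "A' \<subseteq> T \<times> T"
    and "(sat_measure T (H', A'), sat_measure T (H, A)) \<in> less_than <*lex*> less_than <*lex*> less_than"
    by auto
qed

section \<open>Saturation and storing reach final states\<close>

lemma sat_normal_form_exists:
  assumes "finite U"
  obtains H A where "sat_step\<^sup>*\<^sup>* ({}, U) (H, A)" "\<nexists>c. sat_step (H, A) c" "finite A"
proof -
  obtain T where T: "finite T" "U \<subseteq> T \<times> T" "\<And>f ts. Fun f ts \<in> T \<Longrightarrow> set ts \<subseteq> T"
    using finite_subterm_closed_superset[OF assms] by blast
  let ?R = "inv_image (less_than <*lex*> less_than <*lex*> less_than) (sat_measure T)"
  have decr: "snd b \<subseteq> T \<times> T \<and> (b, a) \<in> ?R" if "snd a \<subseteq> T \<times> T" "sat_step a b" for a b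
    using that sat_step_decreases[OF _ T(1,3)] by (cases a; cases b) auto
  have "\<exists>b. sat_step\<^sup>*\<^sup>* ({}, U) b \<and> (\<nexists>c. sat_step b c)"
    using T(2) decr by (intro normal_form_exists[of ?R "\<lambda>a. snd a \<subseteq> T \<times> T"]) auto
  then obtain H A where HA: "sat_step\<^sup>*\<^sup>* ({}, U) (H, A)" "\<nexists>c. sat_step (H, A) c"
    by auto
  have "snd (H, A) \<subseteq> T \<times> T"
    using HA(1) by induction (use T(2) decr in auto)
  then have "finite A"
    using T(1) by (simp add: finite_subset[of A "T \<times> T"])
  with HA that show ?thesis
    by blast
qed

lemma store_normal_form_exists:
  assumes "finite A"
  obtains S' A' where "(store_step \<Theta>)\<^sup>*\<^sup>* (S, A) (S', A')" "\<nexists>c. store_step \<Theta> (S', A') c"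
proof -
  have "finite (snd b) \<and> card (snd b) < card (snd a)"
    if "store_step \<Theta> a b" "finite (snd a)" for a b
    using that by cases (metis card_Diff1_less finite_Diff snd_conv)
  then have "\<exists>b. (store_step \<Theta>)\<^sup>*\<^sup>* (S, A) b \<and> (\<nexists>c. store_step \<Theta> b c)"
    using assms
    by (intro normal_form_exists[of "measure (card \<circ> snd)" "\<lambda>a. finite (snd a)"]) auto
  then show ?thesis
    using that by auto
qed

theorem theorem3:
  fixes ar :: "'f \<Rightarrow> nat"
    and \<Theta> :: "('f, 'v::{countable, infinite}) schema"
    and U :: "('f, 'v) eqn set"
  assumes "substitution_schema ar \<Theta>"
    and "finite U"
    and "wf_eqns ar U"
    and "unifiable ar U"
  shows "store_of \<Theta> U \<noteq> None"
proof -
  obtain \<sigma> where \<sigma>: "unifies \<sigma> U"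
    using assms(4) by (auto simp: unifiable_def unifies_def)
  obtain H A where sat: "sat_step\<^sup>*\<^sup>* ({}, U) (H, A)" "\<nexists>c. sat_step (H, A) c" "finite A"
    using sat_normal_form_exists[OF assms(2)] .
  obtain S' A' where store:
    "(store_step \<Theta>)\<^sup>*\<^sup>* ({}, A) (S', A')" "\<nexists>c. store_step \<Theta> (S', A') c"
    using store_normal_form_exists[OF sat(3)] .
  have A: "unifies \<sigma> A"
    using sat_steps_unifies[OF sat(1) \<sigma>] .
  then have "\<not> unif_fails (S' \<union> A')"
    using store_steps_union[OF store(1)] unifies_not_unif_fails by auto
  then have "theta_unif \<Theta> U (Some (S', A'))"
    using theta_unif.success[OF sat(1) unifies_not_clash[OF A] sat(2) store] by simp
  \<comment> \<open>\<open>fin_config\<close> is \<open>None\<close> if some run fails or if none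
    succeeds: the unifier excludes the former, the run just built the latter.\<close>
  then show ?thesis
    using unifies_not_theta_unif_None[OF \<sigma>, of \<Theta>] by (auto simp: store_of_def fin_config_def)
qed

end
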